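(* Fix $0<\alpha<1$ and $0<\epsilon<1$. Let $\mathcal{U}(\mathcal{S},\epsilon,\alpha)$ be a set obtained from the data $\mathcal{S}$ by the three-step schema described in the context. Then, with probability at least $1-\alpha$ with respect to the sampling of $\mathcal{S}$, the set $\mathcal{U}(\mathcal{S},\epsilon,\alpha)$ implies a probabilistic guarantee at level $\epsilon$ for $\mathbb{P}^*$.
   Context: $\mathbb{P}^*$ is an unknown Borel probability measure on $\mathbb{R}^d$, $\tilde{\mathbf{u}}$ is a random vector, and $\mathcal{S}=\{\hat{\mathbf{u}}^1,\dots,\hat{\mathbf{u}}^N\}$ is drawn i.i.d. from $\mathbb{P}^*$; "probability with respect to the sampling" refers to the $N$-fold product measure $\mathbb{P}^*_{\mathcal{S}}$. For a probability measure $\mathbb{P}$, $\mathrm{VaR}_\epsilon^{\mathbb{P}}(\mathbf{v})=\inf\{t:\mathbb{P}(\tilde{\mathbf{u}}^T\mathbf{v}\le t)\ge 1-\epsilon\}$. The support function is $\delta^*(\mathbf{v}\mid\mathcal{U})=\sup_{\mathbf{u}\in\mathcal{U}}\mathbf{v}^T\mathbf{u}$. A function $g$ is positively homogeneous if $g(\lambda\mathbf{v})=\lambda g(\mathbf{v})$ for all $\lambda>0$. A set $\mathcal{U}$ implies a probabilistic guarantee for $\mathbb{P}^*$ at level $\epsilon$ if for every $\mathbf{x}^*\in\mathbb{R}^k$ and every real-valued $f(\mathbf{u},\mathbf{x})$ concave in $\mathbf{u}$ for all $\mathbf{x}$: if $f(\mathbf{u},\mathbf{x}^* )\le0$ for all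 $\mathbf{u}\in\mathcal{U}$, then $\mathbb{P}^*(f(\tilde{\mathbf{u}},\mathbf{x}^* )\le0)\ge1-\epsilon$. Schema. Step 1: let $\mathcal{P}(\mathcal{S},\alpha,\epsilon)$ be the confidence region of a hypothesis test at level $\alpha$, i.e. a data-dependent set of probability measures such that $\mathbb{P}^*_{\mathcal{S}}(\mathbb{P}^*\in\mathcal{P}(\mathcal{S},\alpha,\epsilon))\ge1-\alpha$. Step 2: construct a (real-valued) convex, positively homogeneous in $\mathbf{v}$, function $g(\mathbf{v},\mathcal{S},\epsilon,\alpha)$ with $\sup_{\mathbb{P}\in\mathcal{P}(\mathcal{S},\alpha,\epsilon)}\mathrm{VaR}_\epsilon^{\mathbb{P}}(\mathbf{v})\le g(\mathbf{v},\mathcal{S},\epsilon,\alpha)$ for all $\mathbf{v}\in\mathbb{R}^d$. Step 3: let $\mathcal{U}(\mathcal{S},\epsilon,\alpha)$ be the closed convex set with $\delta^*(\mathbf{v}\mid\mathcal{U}(\mathcal{S},\epsilon,\alpha))=g(\mathbf{v},\mathcal{S},\epsilon,\alpha)$ for all $\mathbf{v}$. *)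

theory Defs
  imports "HOL-Probability.Probability"
begin

definition borel_prob_measure :: "(real^'d::finite) measure \<Rightarrow> bool" where
  "borel_prob_measure P \<longleftrightarrow> prob_space P \<and> sets P = sets borel"

text \<open>
  The infimum is taken in the extended reals; it is finite for a Borel probability
  measure and \<open>0 < \<epsilon> < 1\<close>.
\<close>
definition VaR :: "real \<Rightarrow> (real^'d::finite) measure \<Rightarrow> real^'d \<Rightarrow> ereal" where
  "VaR \<epsilon> P v = (INF t\<in>{t. measure P {u. u \<bullet> v \<le> t} \<ge> 1 - \<epsilon>}. ereal t)"

text \<open>
  The value is \<open>-\<infinity>\<close> for the empty set and \<open>\<infinity>\<close> in directions in which \<open>U\<close> is unbounded.
\<close>
definition support_function :: "(real^'d::finite) set \<Rightarrow> real^'d \<Rightarrow> ereal" where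
  "support_function U v = (SUP u\<in>U. ereal (v \<bullet> u))"

definition pos_homogeneous :: "(real^'d::finite \<Rightarrow> real) \<Rightarrow> bool" where
  "pos_homogeneous g \<longleftrightarrow> (\<forall>c>0. \<forall>v. g (c *\<^sub>R v) = c * g v)"

text \<open>
  The type argument fixes the dimension of the decision variable \<open>x\<close>. The event below is
  always Borel, since a concave real-valued function on the whole space is continuous.
\<close>
definition implies_prob_guarantee ::
    "'k::finite itself \<Rightarrow> (real^'d::finite) measure \<Rightarrow> real \<Rightarrow> (real^'d) set \<Rightarrow> bool" where
  "implies_prob_guarantee _ P \<epsilon> U \<longleftrightarrow>
     (\<forall>(x0 :: real^'k) (f :: real^'d \<Rightarrow> real^'k \<Rightarrow> real).
        (\<forall>x. concave_on UNIV (\<lambda>u. f u x)) \<longrightarrow>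
        (\<forall>u\<in>U. f u x0 \<le> 0) \<longrightarrow>
        measure P {u. f u x0 \<le> 0} \<ge> 1 - \<epsilon>)"

text \<open>
  The \<open>N\<close>-fold product measure: a sample \<open>S\<close> consists of the points \<open>S 1, \<dots>, S N\<close>.
\<close>
definition sampling :: "nat \<Rightarrow> (real^'d::finite) measure \<Rightarrow> (nat \<Rightarrow> real^'d) measure" where
  "sampling N P = PiM {1..N} (\<lambda>_. P)"

text \<open>
  \<open>Q\<close> holds with probability at least \<open>p\<close>. The event \<open>{s. Q s}\<close> need not be measurable, so
  it is only required to contain a measurable event of probability at least \<open>p\<close>; for
  a measurable event this is the usual meaning, as the lemma below shows.
\<close>
definition holds_with_prob_at_least :: "'s measure \<Rightarrow> real \<Rightarrow> ('s \<Rightarrow> bool) \<Rightarrow> bool" where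
  "holds_with_prob_at_least M p Q \<longleftrightarrow> (\<exists>A\<in>sets M. (\<forall>s\<in>A. Q s) \<and> measure M A \<ge> p)"

lemma holds_with_prob_at_least_iff_measure:
  assumes "prob_space M" and "{s \<in> space M. Q s} \<in> sets M"
  shows "holds_with_prob_at_least M p Q \<longleftrightarrow> measure M {s \<in> space M. Q s} \<ge> p"
proof
  interpret prob_space M by fact
  assume "holds_with_prob_at_least M p Q"
  then obtain A where A: "A \<in> sets M" "\<forall>s\<in>A. Q s" "p \<le> measure M A"
    unfolding holds_with_prob_at_least_def by (elim bexE conjE)
  have "A \<subseteq> {s \<in> space M. Q s}"
    using A(2) sets.sets_into_space[OF A(1)] by (auto simp: subset_iff)
  then have "measure M A \<le> measure M {s \<in> space M. Q s}"
    using assms(2) by (rule finite_measure_mono)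
  then show "measure M {s \<in> space M. Q s} \<ge> p"
    using A(3) by simp
next
  assume "measure M {s \<in> space M. Q s} \<ge> p"
  then show "holds_with_prob_at_least M p Q"
    unfolding holds_with_prob_at_least_def
    by (intro bexI[of _ "{s \<in> space M. Q s}"] conjI assms(2)) simp_all
qed

end

theory Submission
  imports Defs
begin

text \<open>
  On the event that the confidence region contains \<open>Pstar\<close>, the value at risk of \<open>Pstar\<close> is
  bounded by the support function of the set \<open>\<U> S\<close> in every direction. For a
  nonempty convex set \<open>U\<close>, such a bound yields the probabilistic guarantee (lemma \<open>implies_prob_guarantee_if_VaR_le_support_function\<close>).

  If \<open>f\<close> is concave and nonpositive on \<open>U\<close>, the set on which the constraint is violated,
  where \<open>f\<close> is positive, is convex, open (a finite concave function is continuous) and disjoint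
  from \<open>U\<close>. A hyperplane \<open>{u. u \<bullet> v = b}\<close> separates the two sets, and as the violation set is
  open, it lies strictly beyond the hyperplane. Hence the violation set is contained in
  \<open>{u. u \<bullet> v > b}\<close>, while the support function of \<open>U\<close> at \<open>v\<close>, and with it the value at risk, is at
  most \<open>b\<close>. So the half-space \<open>{u. u \<bullet> v > b}\<close> has probability at most \<open>\<epsilon>\<close>
  (lemma \<open>VaR_le_imp_measure_ge\<close>).
\<close>

text \<open>
  Every \<open>t > b\<close> exceeds a member of the set whose infimum is the value at risk, so the
  probability bound holds at \<open>t\<close>. It passes to \<open>b\<close> because distribution functions are continuous
  from the right.
\<close>
lemma VaR_le_imp_measure_ge:
  fixes P :: "(real^'d::finite) measure"
  assumes "borel_prob_measure P" and "VaR \<epsilon> P v \<le> ereal b"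
  shows "measure P {u. u \<bullet> v \<le> b} \<ge> 1 - \<epsilon>"
proof -
  interpret prob_space P
    using assms(1) by (simp add: borel_prob_measure_def)
  have sets_P: "sets P = sets borel"
    using assms(1) by (simp add: borel_prob_measure_def)
  have halfspace_sets: "{u. u \<bullet> v \<le> t} \<in> sets P" for t
    unfolding sets_P by measurable
  define A where "A n = {u. u \<bullet> v \<le> b + 1 / real (Suc n)}" for n
  have A_ge: "1 - \<epsilon> \<le> measure P (A n)" for n
  proof -
    have "VaR \<epsilon> P v < ereal (b + 1 / real (Suc n))"
      using assms(2) by (rule le_less_trans) simp
    then obtain t where t: "1 - \<epsilon> \<le> measure P {u. u \<bullet> v \<le> t}" "t < b + 1 / real (Suc n)"
      by (auto simp: VaR_def INF_less_iff)
    have "measure P {u. u \<bullet> v \<le> t} \<le> measure P (A n)"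
      using t(2) halfspace_sets by (intro finite_measure_mono) (auto simp: A_def)
    with t(1) show ?thesis by simp
  qed
  have "decseq A"
    by (auto simp: decseq_def A_def frac_le elim!: order_trans)
  moreover have "range A \<subseteq> sets P"
    using halfspace_sets by (auto simp: A_def)
  ultimately have "(\<lambda>n. measure P (A n)) \<longlonglongrightarrow> measure P (\<Inter>n. A n)"
    by (intro finite_Lim_measure_decseq)
  moreover have "(\<Inter>n. A n) = {u. u \<bullet> v \<le> b}"
  proof (intro equalityI subsetI)
    fix u assume "u \<in> (\<Inter>n. A n)"
    then have "\<forall>n. u \<bullet> v \<le> b + inverse (real (Suc n))"
      by (simp add: A_def inverse_eq_divide)
    moreover have "(\<lambda>n. b + inverse (real (Suc n))) \<longlonglongrightarrow> b"
      using LIMSEQ_inverse_real_of_nat_add .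
    ultimately have "u \<bullet> v \<le> b"
      by (intro LIMSEQ_le_const) auto
    then show "u \<in> {u. u \<bullet> v \<le> b}" by simp
  qed (auto simp: A_def intro: order_trans)
  ultimately show ?thesis
    using A_ge by (auto intro: LIMSEQ_le_const)
qed

text \<open>
  Separation of convex sets only gives a weak inequality on both sides; moving a point of the
  open set against the normal vector improves it on that side.
\<close>
lemma separating_hyperplane_convex_open:
  fixes U C :: "'a::euclidean_space set"
  assumes "convex U" "U \<noteq> {}" "convex C" "C \<noteq> {}" "open C" "U \<inter> C = {}"
  obtains v b where "\<And>u. u \<in> U \<Longrightarrow> v \<bullet> u \<le> b" "\<And>u. u \<in> C \<Longrightarrow> b < v \<bullet> u"
proof -
  obtain v b where v: "v \<noteq> 0" "\<forall>u\<in>U. v \<bullet> u \<le> b" "\<forall>u\<in>C. b \<le> v \<bullet> u"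
    using separating_hyperplane_sets[OF assms(1,3,2,4,6)] by blast
  have "b < v \<bullet> u" if u: "u \<in> C" for u
  proof -
    obtain e where e: "e > 0" "ball u e \<subseteq> C"
      using \<open>open C\<close> u by (meson open_contains_ball)
    define w where "w = u - (e / (2 * norm v)) *\<^sub>R v"
    have "w \<in> ball u e"
      using e(1) v(1) by (simp add: w_def dist_norm)
    then have "b \<le> v \<bullet> w"
      using e(2) v(3) by blast
    also have "v \<bullet> w < v \<bullet> u"
      using e(1) v(1) by (simp add: w_def inner_diff_right)
    finally show ?thesis .
  qed
  with v(2) that show ?thesis by blast
qed

lemma convex_superlevel_concave:
  assumes "concave_on UNIV f"
  shows "convex {u. c < f u}"
proof (rule convexI)
  fix x y and a b :: real
  assume xy: "x \<in> {u. c < f u}" "y \<in> {u. c < f u}" and ab: "0 \<le> a" "0 \<le> b" "a + b = 1"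
  have "a * - f x + b * - f y < - c"
    using xy ab by (intro convex_bound_lt) auto
  moreover have "a * f x + b * f y \<le> f (a *\<^sub>R x + b *\<^sub>R y)"
    using assms ab by (simp add: concave_on_iff)
  ultimately show "a *\<^sub>R x + b *\<^sub>R y \<in> {u. c < f u}"
    by simp
qed

lemma open_superlevel_concave:
  fixes f :: "'a::euclidean_space \<Rightarrow> real"
  assumes "concave_on UNIV f"
  shows "open {u. c < f u}"
proof -
  have "continuous_on UNIV (\<lambda>u. - f u)"
    using assms unfolding concave_on_def by (intro convex_on_continuous) auto
  then have "continuous_on UNIV f"
    using continuous_on_minus by fastforce
  then show ?thesis
    by (intro open_Collect_less continuous_on_const)
qed

lemma implies_prob_guarantee_if_VaR_le_support_function:
  fixes P :: "(real^'d::finite) measure"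
  assumes "borel_prob_measure P" and "0 \<le> \<epsilon>"
    and "convex U" "U \<noteq> {}"
    and VaR_le: "\<And>v. VaR \<epsilon> P v \<le> support_function U v"
  shows "implies_prob_guarantee TYPE('k::finite) P \<epsilon> U"
  unfolding implies_prob_guarantee_def
proof (intro allI impI)
  fix x0 :: "real^'k" and f :: "real^'d \<Rightarrow> real^'k \<Rightarrow> real"
  assume "\<forall>x. concave_on UNIV (\<lambda>u. f u x)" and f_le: "\<forall>u\<in>U. f u x0 \<le> 0"
  then have concave: "concave_on UNIV (\<lambda>u. f u x0)" by simp
  interpret prob_space P
    using assms(1) by (simp add: borel_prob_measure_def)
  have sets_P: "sets P = sets borel"
    using assms(1) by (simp add: borel_prob_measure_def)
  have space_P: "space P = UNIV"
    using sets_eq_imp_space_eq[OF sets_P] by simp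
  define C where "C = {u. 0 < f u x0}"
  have "open C" and "convex C"
    unfolding C_def
    using open_superlevel_concave[OF concave] convex_superlevel_concave[OF concave] by auto
  have compl_C: "- C = {u. f u x0 \<le> 0}"
    by (auto simp: C_def)
  show "1 - \<epsilon> \<le> measure P {u. f u x0 \<le> 0}"
  proof (cases "C = {}")
    case True
    then have "{u. f u x0 \<le> 0} = space P"
      using compl_C space_P by auto
    then show ?thesis
      using \<open>0 \<le> \<epsilon>\<close> prob_space by simp
  next
    case False
    have "U \<inter> C = {}"
      using f_le by (auto simp: C_def)
    from separating_hyperplane_convex_open[OF assms(3,4) \<open>convex C\<close> False \<open>open C\<close> this]
    obtain v b where U_le: "\<And>u. u \<in> U \<Longrightarrow> v \<bullet> u \<le> b" and C_gt: "\<And>u. u \<in> C \<Longrightarrow> b < v \<bullet> u"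
      by blast
    have "VaR \<epsilon> P v \<le> support_function U v" by (rule VaR_le)
    also have "\<dots> \<le> ereal b"
      unfolding support_function_def using U_le by (intro SUP_least) simp
    finally have "1 - \<epsilon> \<le> measure P {u. u \<bullet> v \<le> b}"
      by (rule VaR_le_imp_measure_ge[OF assms(1)])
    also have "\<dots> \<le> measure P (- C)"
    proof (rule finite_measure_mono)
      show "{u. u \<bullet> v \<le> b} \<subseteq> - C"
        using C_gt by (force simp: inner_commute)
      show "- C \<in> sets P"
        unfolding sets_P using \<open>open C\<close> by (intro borel_closed) (simp add: closed_Compl)
    qed
    finally show ?thesis by (simp add: compl_C)
  qed
qed

theorem theorem2:
  fixes Pstar :: "(real^'d::finite) measure"
    and N :: nat
    and \<alpha> \<epsilon> :: real
    and Conf :: "(nat \<Rightarrow> real^'d) \<Rightarrow> (real^'d) measure set"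
    and g :: "real^'d \<Rightarrow> (nat \<Rightarrow> real^'d) \<Rightarrow> real"
    and \<U> :: "(nat \<Rightarrow> real^'d) \<Rightarrow> (real^'d) set"
  assumes "0 < \<alpha>" and "\<alpha> < 1" and "0 < \<epsilon>" and "\<epsilon> < 1"
    and "borel_prob_measure Pstar"
    and "\<And>S P. S \<in> space (sampling N Pstar) \<Longrightarrow> P \<in> Conf S \<Longrightarrow> borel_prob_measure P"
    and "holds_with_prob_at_least (sampling N Pstar) (1 - \<alpha>) (\<lambda>S. Pstar \<in> Conf S)"
    and "\<And>S. S \<in> space (sampling N Pstar) \<Longrightarrow> convex_on UNIV (\<lambda>v. g v S)"
    and "\<And>S. S \<in> space (sampling N Pstar) \<Longrightarrow> pos_homogeneous (\<lambda>v. g v S)"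
    and "\<And>S v. S \<in> space (sampling N Pstar) \<Longrightarrow> (SUP P\<in>Conf S. VaR \<epsilon> P v) \<le> ereal (g v S)"
    and "\<And>S. S \<in> space (sampling N Pstar) \<Longrightarrow> closed (\<U> S)"
    and "\<And>S. S \<in> space (sampling N Pstar) \<Longrightarrow> convex (\<U> S)"
    and "\<And>S v. S \<in> space (sampling N Pstar) \<Longrightarrow> support_function (\<U> S) v = ereal (g v S)"
  shows "holds_with_prob_at_least (sampling N Pstar) (1 - \<alpha>)
           (\<lambda>S. implies_prob_guarantee TYPE('k::finite) Pstar \<epsilon> (\<U> S))"
proof -
  obtain A where A: "A \<in> sets (sampling N Pstar)" "\<forall>S\<in>A. Pstar \<in> Conf S"
      "1 - \<alpha> \<le> measure (sampling N Pstar) A"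
    using assms(7) unfolding holds_with_prob_at_least_def by blast
  have "implies_prob_guarantee TYPE('k) Pstar \<epsilon> (\<U> S)" if "S \<in> A" for S
  proof -
    have S: "S \<in> space (sampling N Pstar)"
      using A(1) that sets.sets_into_space by blast
    have "VaR \<epsilon> Pstar v \<le> support_function (\<U> S) v" for v
    proof -
      have "VaR \<epsilon> Pstar v \<le> (SUP P\<in>Conf S. VaR \<epsilon> P v)"
        using A(2) that by (intro SUP_upper) blast
      also have "\<dots> \<le> ereal (g v S)"
        using S by (rule assms(10))
      finally show ?thesis
        by (simp add: assms(13)[OF S])
    qed
    \<comment> \<open>The support function of the empty set is \<open>-\<infinity>\<close>, whereas \<open>g\<close> takes real values.\<close>
    moreover have "\<U> S \<noteq> {}"
      using assms(13)[OF S, of 0] by (auto simp: support_function_def bot_ereal_def)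
    ultimately show ?thesis
      using assms(3,5) assms(12)[OF S]
      by (intro implies_prob_guarantee_if_VaR_le_support_function) auto
  qed
  with A(1,3) show ?thesis
    unfolding holds_with_prob_at_least_def by blast
qed

end
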